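(* Let $Y\sim N(0,1)$ be a standard normal random variable. For every integer $n\ge 0$ and every real $x$, $$\frac{1}{2}\bigg(\sum_{l=0}^{n}\binom{n}{l}\mathcal{E}_{l,\lambda}^{Y}(x)E\big[(Y)_{n-l,\lambda}\big]+\mathcal{E}_{n,\lambda}^{Y}(x)\bigg)=\sum_{j=0}^{n}\sum_{k=0}^{[j/2]}\frac{(2k)!}{2^{k}k!}S_{1}(j,2k){n \brace j}_{\lambda}x^{k}.$$
   Context: $\lambda$ is a fixed nonzero real number, and $[j/2]$ denotes the integer part of $j/2$. For real $x$ and $n\ge1$: $(x)_{n}=x(x-1)\cdots(x-n+1)$, $(x)_{n,\lambda}=x(x-\lambda)\cdots(x-(n-1)\lambda)$, and $(x)_0=(x)_{0,\lambda}=1$. The (signed) Stirling numbers of the first kind $S_1(n,k)$ and the degenerate Stirling numbers of the second kind ${n\brace k}_\lambda$ are defined by the polynomial identities $(x)_n=\sum_{k=0}^nS_1(n,k)x^k$ and $(x)_{n,\lambda}=\sum_{k=0}^n{n\brace k}_\lambda(x)_k$, $n\ge0$. The degenerate exponential is $e_{\lambda}^{x}(t)=(1+\lambda t)^{x/\lambda}=\sum_{n\ge0}(x)_{n,\lambda}\frac{t^n}{n!}$, and $E[e_{\lambda}^{Y}(t)]=\sum_{n\ge0}E[(Y)_{n,\lambda}]\frac{t^n}{n!}$ for $t$ near $0$ (here $E[\cdot]$ is expectation). The probabilistic degenerate Euler polynomials associated with $Y$ are defined by the power series expansion at $t=0$: $\frac{2}{E[e_{\lambda}^{Y}(t)]+1}\big(E[e_{\lambda}^{Y}(t)]\big)^{x}=\sum_{n\ge0}\mathcal{E}_{n,\lambda}^{Y}(x)\frac{t^n}{n!}$.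 *)

theory Defs
  imports "HOL-Probability.Probability"
begin

definition ffact :: "real \<Rightarrow> nat \<Rightarrow> real" where
  "ffact x n = (\<Prod>i<n. x - real i)"

definition deg_ffact :: "real \<Rightarrow> real \<Rightarrow> nat \<Rightarrow> real" where
  "deg_ffact lam x n = (\<Prod>i<n. x - real i * lam)"

text \<open>
  The Stirling numbers are the coefficients of an expansion in the bases $x^k$ and $(x)_k$,
  respectively. Setting the coefficients with \<open>k > n\<close> to zero makes the coefficient
  sequence unique.
\<close>

definition S1 :: "nat \<Rightarrow> nat \<Rightarrow> real" where
  "S1 n = (THE c. (\<forall>k>n. c k = 0) \<and> (\<forall>x. ffact x n = (\<Sum>k=0..n. c k * x ^ k)))"

definition deg_S2 :: "real \<Rightarrow> nat \<Rightarrow> nat \<Rightarrow> real" where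
  "deg_S2 lam n =
     (THE c. (\<forall>k>n. c k = 0) \<and> (\<forall>x. deg_ffact lam x n = (\<Sum>k=0..n. c k * ffact x k)))"

definition deg_exp :: "real \<Rightarrow> real \<Rightarrow> real \<Rightarrow> real" where
  "deg_exp lam x t = (1 + lam * t) powr (x / lam)"

definition deg_mgf :: "real \<Rightarrow> 'a measure \<Rightarrow> ('a \<Rightarrow> real) \<Rightarrow> real \<Rightarrow> real" where
  "deg_mgf lam M Y t = (\<integral>\<omega>. deg_exp lam (Y \<omega>) t \<partial>M)"

text \<open>
  For fixed \<open>x\<close>, the sequence in \<open>n\<close> is the unique coefficient sequence whose exponential
  power series converges to the generating function on a neighbourhood of \<open>t = 0\<close>. It is
  meaningful only if such an expansion exists.
\<close>

definition prob_deg_euler ::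
    "real \<Rightarrow> 'a measure \<Rightarrow> ('a \<Rightarrow> real) \<Rightarrow> nat \<Rightarrow> real \<Rightarrow> real" where
  "prob_deg_euler lam M Y n x =
     (THE c :: nat \<Rightarrow> real. \<forall>\<^sub>F t in nhds 0.
        (\<lambda>m. c m * t ^ m / fact m) sums
          (2 / (deg_mgf lam M Y t + 1) * deg_mgf lam M Y t powr x)) n"

end

theory Submission
  imports Defs "HOL-Complex_Analysis.Complex_Analysis"
begin

text \<open>
  Put \<open>s = ln (1 + \<lambda>t) / \<lambda>\<close>, so that \<open>e\<^sub>\<lambda>\<^sup>y(t) = exp (y s)\<close> and, for standard normal \<open>Y\<close>,
  \<open>E[e\<^sub>\<lambda>\<^sup>Y(t)] = exp (s\<^sup>2/2)\<close>. Multiplying the generating function of the Euler polynomials by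
  \<open>(E[e\<^sub>\<lambda>\<^sup>Y(t)] + 1) / 2\<close> leaves \<open>exp (x s\<^sup>2/2)\<close>. Comparing powers of \<open>y\<close> in \<open>exp (y s)\<close> shows
  that \<open>s\<^sup>m/m!\<close> is the exponential generating function (in \<open>n\<close>) of the coefficient of \<open>y\<^sup>m\<close> in
  \<open>(y)\<^sub>n\<^sub>,\<^sub>\<lambda>\<close>, a sum of products of Stirling numbers; this expands \<open>exp (x s\<^sup>2/2)\<close>. Its coefficients
  at \<open>x = 1\<close> are also the moments \<open>E[(Y)\<^sub>n\<^sub>,\<^sub>\<lambda>]\<close>, by the formula for Gaussian moments, so the
  Cauchy product gives the claim.
\<close>

unbundle no vec_syntax
unbundle fps_syntax

section \<open>Stirling numbers\<close>

lemma ffact_Suc: "ffact x (Suc n) = (x - real n) * ffact x n"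
  by (simp add: ffact_def)

lemma deg_ffact_Suc: "deg_ffact lam x (Suc n) = (x - real n * lam) * deg_ffact lam x n"
  by (simp add: deg_ffact_def)

lemma ffact_eq_0: "m < k \<Longrightarrow> ffact (real m) k = 0"
  by (auto simp: ffact_def)

lemma ffact_self_neq_0: "ffact (real m) m \<noteq> 0"
  by (auto simp: ffact_def)

text \<open>Makes the definite description usable: expanding the product as a polynomial gives
  existence, and a polynomial function determines its coefficients.\<close>

lemma S1_spec: "(\<forall>k>n. S1 n k = 0) \<and> (\<forall>x. ffact x n = (\<Sum>k=0..n. S1 n k * x ^ k))"
proof -
  let ?P = "\<lambda>c. (\<forall>k>n. c k = 0) \<and> (\<forall>x. ffact x n = (\<Sum>k=0..n. c k * x ^ k))"
  have "\<exists>!c. ?P c"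
  proof (rule ex_ex1I)
    define p :: "real poly" where "p = (\<Prod>i<n. [:- real i, 1:])"
    have "degree p \<le> n"
      unfolding p_def by (rule order.trans[OF degree_prod_sum_le]) auto
    have "ffact x n = (\<Sum>k=0..n. coeff p k * x ^ k)" for x
    proof -
      have "ffact x n = poly p x"
        by (simp add: p_def ffact_def poly_prod)
      also have "\<dots> = (\<Sum>k=0..n. coeff p k * x ^ k)"
        unfolding poly_altdef using \<open>degree p \<le> n\<close>
        by (intro sum.mono_neutral_left) (auto simp: coeff_eq_0)
      finally show ?thesis .
    qed
    with \<open>degree p \<le> n\<close> show "\<exists>c. ?P c"
      by (intro exI[of _ "coeff p"]) (auto simp: coeff_eq_0)
  next
    fix c d assume c: "?P c" and d: "?P d"
    then have "\<forall>x. (\<Sum>k\<le>n. c k * x ^ k) = (\<Sum>k\<le>n. d k * x ^ k)"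
      by (simp flip: atLeast0AtMost)
    then have "\<forall>k\<le>n. c k = d k"
      by (simp only: polyfun_eq_coeffs)
    with c d show "c = d"
      by (metis ext not_le)
  qed
  then show ?thesis
    unfolding S1_def by (rule theI')
qed

lemmas S1_eq_0 = S1_spec[THEN conjunct1, rule_format]
  and ffact_expand = S1_spec[THEN conjunct2, rule_format]

lemma deg_ffact_in_ffact_basis:
  "\<exists>c. (\<forall>k>n. c k = 0) \<and> (\<forall>x. deg_ffact lam x n = (\<Sum>k=0..n. c k * ffact x k))"
proof (induction n)
  case 0
  show ?case
    by (intro exI[of _ "\<lambda>k. if k = 0 then 1 else 0"]) (simp add: deg_ffact_def ffact_def)
next
  case (Suc n)
  then obtain c where c: "\<forall>k>n. c k = 0" "\<And>x. deg_ffact lam x n = (\<Sum>k=0..n. c k * ffact x k)"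
    by blast
  \<comment> \<open>From x - n lam = (x - k) + (k - n lam): the first summand raises
    \<open>ffact x k\<close> to \<open>ffact x (Suc k)\<close>, the second only rescales it.\<close>
  define d where
    "d k = (if k = 0 then 0 else c (k - 1)) + (real k - real n * lam) * c k" for k
  have "deg_ffact lam x (Suc n) = (\<Sum>k=0..Suc n. d k * ffact x k)" for x
  proof -
    have "deg_ffact lam x (Suc n) = (\<Sum>k=0..n. c k * ((x - real n * lam) * ffact x k))"
      by (simp add: deg_ffact_Suc c(2) sum_distrib_left mult_ac)
    also have "\<dots> = (\<Sum>k=0..n. c k * ffact x (Suc k) + (real k - real n * lam) * c k * ffact x k)"
      by (intro sum.cong refl) (simp add: ffact_Suc algebra_simps)
    also have "\<dots> = (\<Sum>k=0..n. c k * ffact x (Suc k))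
        + (\<Sum>k=0..Suc n. (real k - real n * lam) * c k * ffact x k)"
      using c(1) by (simp add: sum.distrib)
    also have "(\<Sum>k=0..n. c k * ffact x (Suc k))
        = (\<Sum>k=0..Suc n. (if k = 0 then 0 else c (k - 1)) * ffact x k)"
      by (subst sum.atLeast0_atMost_Suc_shift) simp
    finally show ?thesis
      by (simp add: d_def distrib_right sum.distrib del: sum.atLeast0_atMost_Suc)
  qed
  moreover have "\<forall>k>Suc n. d k = 0"
    using c(1) by (auto simp: d_def)
  ultimately show ?case by blast
qed

text \<open>Evaluating at \<open>x = k\<close> kills all terms above the \<open>k\<close>-th.\<close>
lemma ffact_independent:
  assumes "\<And>x. (\<Sum>k=0..n. c k * ffact x k) = 0" and "k \<le> n"
  shows "c k = 0"
  using assms(2)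
proof (induction k rule: less_induct)
  case (less k)
  have "0 = (\<Sum>i=0..n. c i * ffact (real k) i)"
    by (simp add: assms(1))
  also have "\<dots> = (\<Sum>i\<in>{k}. c i * ffact (real k) i)"
    using less by (intro sum.mono_neutral_right) (auto simp: ffact_eq_0 neq_iff)
  finally show ?case
    by (simp add: ffact_self_neq_0)
qed

lemma deg_S2_spec:
  "(\<forall>k>n. deg_S2 lam n k = 0) \<and> (\<forall>x. deg_ffact lam x n = (\<Sum>k=0..n. deg_S2 lam n k * ffact x k))"
proof -
  let ?P = "\<lambda>c. (\<forall>k>n. c k = 0) \<and> (\<forall>x. deg_ffact lam x n = (\<Sum>k=0..n. c k * ffact x k))"
  have "\<exists>!c. ?P c"
  proof (rule ex_ex1I)
    show "\<exists>c. ?P c"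
      by (rule deg_ffact_in_ffact_basis)
  next
    fix c d assume c: "?P c" and d: "?P d"
    then have "(\<Sum>k=0..n. (c k - d k) * ffact x k) = 0" for x
      by (simp add: left_diff_distrib sum_subtractf)
    then have "k \<le> n \<Longrightarrow> c k - d k = 0" for k
      by (rule ffact_independent[where c = "\<lambda>k. c k - d k"])
    with c d show "c = d"
      by (metis eq_iff_diff_eq_0 ext not_le)
  qed
  then show ?thesis
    unfolding deg_S2_def by (rule theI')
qed

lemmas deg_ffact_expand = deg_S2_spec[THEN conjunct2, rule_format]

text \<open>Change of basis through the falling factorials; \<open>deg_ffact_monomials\<close>
  identifies this as the coefficient of x^m in \<open>deg_ffact lam x n\<close>.\<close>

definition deg_ffact_coeff :: "real \<Rightarrow> nat \<Rightarrow> nat \<Rightarrow> real" where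
  "deg_ffact_coeff lam n m = (\<Sum>j=0..n. deg_S2 lam n j * S1 j m)"

lemma deg_ffact_coeff_eq_0: "n < m \<Longrightarrow> deg_ffact_coeff lam n m = 0"
  by (simp add: deg_ffact_coeff_def S1_eq_0)

lemma deg_ffact_monomials: "deg_ffact lam x n = (\<Sum>m\<le>n. deg_ffact_coeff lam n m * x ^ m)"
proof -
  have "ffact x j = (\<Sum>m\<le>n. S1 j m * x ^ m)" if "j \<le> n" for j
    unfolding ffact_expand using that
    by (intro sum.mono_neutral_left) (auto simp: S1_eq_0)
  then have "deg_ffact lam x n = (\<Sum>j=0..n. \<Sum>m\<le>n. deg_S2 lam n j * S1 j m * x ^ m)"
    by (simp add: deg_ffact_expand sum_distrib_left mult_ac)
  also have "\<dots> = (\<Sum>m\<le>n. deg_ffact_coeff lam n m * x ^ m)"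
    by (subst sum.swap) (simp add: deg_ffact_coeff_def sum_distrib_right)
  finally show ?thesis .
qed

text \<open>The weight (2k)!/(2^k k!) is the Gaussian moment of order 2k. Summing up to n instead of
  n/2 adds only zeros, since \<open>deg_ffact_coeff lam n (2 * k)\<close> vanishes for 2k > n, and
  it matches the range of \<open>fps_compose_nth\<close>.\<close>

definition gauss_coeff :: "real \<Rightarrow> real \<Rightarrow> nat \<Rightarrow> real" where
  "gauss_coeff lam x n =
     (\<Sum>k\<le>n. fact (2 * k) / (2 ^ k * fact k) * deg_ffact_coeff lam n (2 * k) * x ^ k)"

lemma gauss_coeff_stirling:
  "gauss_coeff lam x n = (\<Sum>j=0..n. \<Sum>k=0..j div 2.
     fact (2 * k) / (2 ^ k * fact k) * S1 j (2 * k) * deg_S2 lam n j * x ^ k)"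
proof -
  have "gauss_coeff lam x n = (\<Sum>j=0..n. \<Sum>k\<le>n.
     fact (2 * k) / (2 ^ k * fact k) * S1 j (2 * k) * deg_S2 lam n j * x ^ k)"
    unfolding gauss_coeff_def deg_ffact_coeff_def
    by (subst sum.swap) (simp add: sum_distrib_left sum_distrib_right mult_ac)
  also have "\<dots> = (\<Sum>j=0..n. \<Sum>k=0..j div 2.
     fact (2 * k) / (2 ^ k * fact k) * S1 j (2 * k) * deg_S2 lam n j * x ^ k)"
  proof (intro sum.cong[OF refl] sum.mono_neutral_right ballI)
    fix j k assume "k \<in> {..n} - {0..j div 2}"
    then have "j < 2 * k" by auto
    then show "fact (2 * k) / (2 ^ k * fact k) * S1 j (2 * k) * deg_S2 lam n j * x ^ k = 0"
      by (simp add: S1_eq_0)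
  qed auto
  finally show ?thesis .
qed

section \<open>Power series\<close>

text \<open>Constant terms agree because both equal f(0). Differentiating shifts the coefficients
  down by one, so the induction must let the function vary.\<close>

lemma has_fps_expansion_unique:
  fixes f :: "'a :: {banach, real_normed_field} \<Rightarrow> 'a"
  assumes "f has_fps_expansion F" "f has_fps_expansion G"
  shows "F = G"
proof -
  have "F $ n = G $ n" if "f has_fps_expansion F" "f has_fps_expansion G"
    for n and f :: "'a \<Rightarrow> 'a" and F G
    using that
  proof (induction n arbitrary: f F G)
    case 0
    then show ?case
      using has_fps_expansion_imp_0_eq_fps_nth_0[OF 0(1)]
        has_fps_expansion_imp_0_eq_fps_nth_0[OF 0(2)] by simp
  next
    case (Suc n)
    have "fps_deriv F $ n = fps_deriv G $ n"
      by (rule Suc.IH[OF Suc.prems[THEN has_fps_expansion_deriv]])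
    then show ?case
      by (simp del: of_nat_Suc)
  qed
  from fps_ext[OF this[OF assms]] show ?thesis .
qed

text \<open>Puts an expansion into the form that the definition of \<open>prob_deg_euler\<close>
  uses.\<close>

lemma has_fps_expansion_sums:
  assumes "f has_fps_expansion F"
  shows "\<forall>\<^sub>F t in nhds 0. (\<lambda>n. F $ n * t ^ n) sums f t"
proof -
  have "\<forall>\<^sub>F t in nhds 0. t \<in> eball 0 (fps_conv_radius F)"
    using assms by (intro eventually_nhds_in_open) (auto simp: has_fps_expansion_def zero_ereal_def)
  moreover have "\<forall>\<^sub>F t in nhds 0. eval_fps F t = f t"
    using assms by (simp add: has_fps_expansion_def)
  ultimately show ?thesis
  proof eventually_elim
    case (elim t)
    then show ?case
      using sums_eval_fps[of t F] by (simp add: dist_norm)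
  qed
qed

text \<open>Composition of expansions is available in the library only over the complex numbers.\<close>
lemma has_fps_expansion_real:
  fixes g :: "complex \<Rightarrow> complex" and f :: "real \<Rightarrow> real"
  assumes g: "g has_fps_expansion Abs_fps (\<lambda>n. of_real (c n))"
    and "\<forall>\<^sub>F t in nhds 0. g (of_real t) = of_real (f t)"
  shows "f has_fps_expansion Abs_fps c"
proof (rule has_fps_expansionI)
  have "filterlim complex_of_real (nhds 0) (nhds 0)"
    using tendsto_of_real[OF filterlim_ident[of "nhds (0::real)"]] by simp
  from eventually_compose_filterlim[OF has_fps_expansion_sums[OF g] this] assms(2)
  show "\<forall>\<^sub>F t in nhds 0. (\<lambda>n. Abs_fps c $ n * t ^ n) sums f t"
  proof eventually_elim
    case (elim t)
    then have "(\<lambda>n. complex_of_real (c n * t ^ n)) sums of_real (f t)"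
      by simp
    then show ?case
      by (simp only: sums_of_real_iff fps_nth_Abs_fps)
  qed
qed

text \<open>The differential equation characterises \<open>L = log (1 + \<lambda>X) / \<lambda>\<close>, so that
  \<open>exp (y L)\<close> is \<open>(1 + \<lambda>X) powr (y / \<lambda>)\<close>.\<close>
lemma fps_exp_compose_log_nth:
  fixes y a :: "'a :: field_char_0"
  assumes L0: "L $ 0 = 0" and L: "(1 + fps_const a * fps_X) * fps_deriv L = 1"
  shows "(fps_exp y oo L) $ n = (\<Prod>i<n. y - of_nat i * a) / fact n"
proof (induction n)
  case 0
  show ?case by simp
next
  case (Suc n)
  define F where "F = fps_exp y oo L"
  have "fps_deriv F = fps_const y * F * fps_deriv L"
    by (simp add: F_def fps_compose_deriv[OF L0] fps_compose_mult_distrib[OF L0])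
  then have "(1 + fps_const a * fps_X) * fps_deriv F
      = fps_const y * F * ((1 + fps_const a * fps_X) * fps_deriv L)"
    by (simp only: mult_ac)
  then have "fps_deriv F + fps_const a * (fps_X * fps_deriv F) = fps_const y * F"
    by (simp only: L) (simp add: distrib_right mult.assoc)
  then have "(fps_deriv F + fps_const a * (fps_X * fps_deriv F)) $ n = (fps_const y * F) $ n"
    by simp
  \<comment> \<open>For n = 0 the factor \<open>fps_X\<close> kills the coefficient, in agreement
    with \<open>of_nat n\<close>.\<close>
  then have "of_nat (Suc n) * F $ Suc n + a * (of_nat n * F $ n) = y * F $ n"
    by (cases n) (simp_all del: of_nat_Suc)
  then have "F $ Suc n = (y - of_nat n * a) * F $ n / of_nat (Suc n)"
    by (simp add: field_simps del: of_nat_Suc)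
  also have "F $ n = (\<Prod>i<n. y - of_nat i * a) / fact n"
    using Suc.IH by (simp add: F_def)
  finally show ?case
    by (simp add: F_def mult_ac del: of_nat_Suc)
qed

text \<open>The coefficient of X^n in exp(yL) is the sum of y^m (L^m)_n / m!, and also
  \<open>deg_ffact lam y n / fact n\<close>. Both are polynomials in y, so their coefficients
  agree.\<close>

lemma log_power_nth:
  fixes L :: "complex fps"
  assumes L0: "L $ 0 = 0" and L: "(1 + fps_const (of_real lam) * fps_X) * fps_deriv L = 1"
  shows "(L ^ m) $ n = of_real (fact m * deg_ffact_coeff lam n m / fact n)"
proof (cases "m \<le> n")
  case True
  define c where "c m = (L ^ m) $ n / fact m - of_real (deg_ffact_coeff lam n m / fact n)" for m
  have "(\<Sum>m\<le>n. c m * of_real y ^ m) = 0" for y :: real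
  proof -
    have "(\<Sum>m\<le>n. c m * of_real y ^ m) = (fps_exp (of_real y) oo L) $ n
        - of_real (deg_ffact lam y n / fact n)"
      by (simp add: c_def fps_compose_nth atLeast0AtMost deg_ffact_monomials
          sum_divide_distrib algebra_simps flip: sum_subtractf)
    also have "\<dots> = 0"
      by (simp add: fps_exp_compose_log_nth[OF L0 L] deg_ffact_def)
    finally show ?thesis .
  qed
  \<comment> \<open>The identity is known for real y only, but that is already infinitely many roots
    of a complex polynomial.\<close>
  then have "range complex_of_real \<subseteq> {z. (\<Sum>m\<le>n. c m * z ^ m) = 0}"
    by auto
  moreover have "infinite (range complex_of_real)"
    by (simp add: finite_image_iff inj_on_def infinite_UNIV_char_0)
  ultimately have "infinite {z. (\<Sum>m\<le>n. c m * z ^ m) = 0}"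
    by (meson finite_subset)
  then have "c m = 0"
    using True by (auto simp: polyfun_finite_roots)
  then show ?thesis
    by (simp add: c_def field_simps)
next
  case False
  \<comment> \<open>L has no constant term, so L^m starts no earlier than X^m.\<close>
  then show ?thesis
    using startsby_zero_power_prefix[OF L0] by (simp add: deg_ffact_coeff_eq_0)
qed

lemma gauss_has_fps_expansion:
  assumes "lam \<noteq> 0"
  shows "(\<lambda>t::real. exp (x * (ln (1 + lam * t) / lam)\<^sup>2 / 2))
           has_fps_expansion Abs_fps (\<lambda>n. gauss_coeff lam x n / fact n)"
proof -
  define s where "s z = Ln (1 + of_real lam * z) / of_real lam" for z :: complex
  define L where "L = fps_expansion s 0"
  have "s analytic_on {0}"
    unfolding s_def by (intro analytic_intros) (use assms in auto)
  then have sL: "s has_fps_expansion L"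
    unfolding L_def by (rule analytic_at_imp_has_fps_expansion_0)
  then have L0: "L $ 0 = 0"
    using has_fps_expansion_imp_0_eq_fps_nth_0[OF sL] by (simp add: s_def)
  \<comment> \<open>Near 0 the argument of \<open>Ln\<close> avoids the branch cut, so s can be
    differentiated there.\<close>
  have ev: "\<forall>\<^sub>F z in nhds (0::complex). 1 + of_real lam * z \<notin> \<real>\<^sub>\<le>\<^sub>0"
  proof -
    have "open ((\<lambda>z::complex. 1 + of_real lam * z) -` (- \<real>\<^sub>\<le>\<^sub>0))"
      by (intro open_vimage continuous_intros) auto
    from eventually_nhds_in_open[OF this, of 0] show ?thesis
      by simp
  qed
  \<comment> \<open>The differential equation for L follows from that for s, because both sides
    expand the same function.\<close>
  have "(1 + fps_const (of_real lam) * fps_X) * fps_deriv L = 1"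
  proof (rule has_fps_expansion_unique)
    show "(\<lambda>z. (1 + of_real lam * z) * deriv s z) has_fps_expansion
        (1 + fps_const (of_real lam) * fps_X) * fps_deriv L"
      by (intro fps_expansion_intros sL)
    have "\<forall>\<^sub>F z in nhds 0. 1 = (1 + of_real lam * z) * deriv s z"
      using ev
    proof eventually_elim
      case (elim z)
      then have "1 + of_real lam * z \<noteq> 0"
        by auto
      with elim have "(s has_field_derivative 1 / (1 + of_real lam * z)) (at z)"
        unfolding s_def using assms
        by (auto intro!: derivative_eq_intros simp: inverse_eq_divide)
      with \<open>1 + of_real lam * z \<noteq> 0\<close> show ?case
        by (simp add: DERIV_imp_deriv)
    qed
    then show "(\<lambda>z. (1 + of_real lam * z) * deriv s z) has_fps_expansion 1"
      by (subst has_fps_expansion_cong[OF _ refl]) (auto elim: eventually_mono)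
  qed
  note Lpow = log_power_nth[OF L0 this]
  have sq: "(\<lambda>z. 1/2 * (s z * s z)) has_fps_expansion fps_const (1/2) * (L * L)"
    by (intro fps_expansion_intros sL)
  have "((\<lambda>w. exp (of_real x * w)) \<circ> (\<lambda>z. 1/2 * (s z * s z)))
      has_fps_expansion (fps_exp (of_real x) oo (fps_const (1/2) * (L * L)))"
    by (rule has_fps_expansion_compose[OF has_fps_expansion_exp sq]) (simp add: L0)
  also have "(fps_exp (of_real x) oo (fps_const (1/2) * (L * L)))
      = Abs_fps (\<lambda>n. of_real (gauss_coeff lam x n / fact n))"
  proof (rule fps_ext)
    fix n
    \<comment> \<open>The k-th term of the composition has x^k/k! from exp, 1/2^k from here and
      (2k)! from \<open>Lpow\<close>; together these give the weight in
      \<open>gauss_coeff\<close>.\<close>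
    have "(fps_const (1/2) * (L * L)) ^ k = fps_const ((1/2) ^ k) * L ^ (2 * k)" for k
      by (simp add: power_mult_distrib power_mult power2_eq_square fps_const_power)
    then show "(fps_exp (of_real x) oo (fps_const (1/2) * (L * L))) $ n
        = Abs_fps (\<lambda>n. of_real (gauss_coeff lam x n / fact n)) $ n"
      by (simp add: fps_compose_nth Lpow gauss_coeff_def atLeast0AtMost sum_divide_distrib
          power_divide mult_ac)
  qed
  finally show ?thesis
  proof (rule has_fps_expansion_real)
    have "open ((\<lambda>t. 1 + lam * t) -` {0<..})"
      by (intro open_vimage continuous_intros open_greaterThan)
    from eventually_nhds_in_open[OF this, of 0] have "\<forall>\<^sub>F t in nhds 0. 1 + lam * t > 0"
      by simp
    then show "\<forall>\<^sub>F t in nhds 0. ((\<lambda>w. exp (of_real x * w)) \<circ> (\<lambda>z. 1/2 * (s z * s z))) (of_real t)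
        = of_real (exp (x * (ln (1 + lam * t) / lam)\<^sup>2 / 2))"
    proof eventually_elim
      case (elim t)
      then have "s (of_real t) = of_real (ln (1 + lam * t) / lam)"
        unfolding s_def using Ln_of_real[of "1 + lam * t"] by simp
      then have "of_real x * (1/2 * (s (of_real t) * s (of_real t)))
          = complex_of_real (x * (ln (1 + lam * t) / lam)\<^sup>2 / 2)"
        by (simp add: power2_eq_square)
      then show ?case
        by (simp only: o_def exp_of_real)
    qed
  qed
qed

section \<open>Gaussian expectations\<close>

lemma std_normal_mgf:
  assumes Y: "distributed M lborel Y std_normal_density"
  shows "(\<integral>\<omega>. exp (Y \<omega> * s) \<partial>M) = exp (s\<^sup>2 / 2)"
proof -
  have "(\<integral>\<omega>. exp (Y \<omega> * s) \<partial>M) = (\<integral>y. std_normal_density y * exp (y * s) \<partial>lborel)"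
    by (rule distributed_integral[OF Y, symmetric]) auto
  \<comment> \<open>Completing the square: the tilted density is a constant times the normal density
    with mean s.\<close>
  also have "\<dots> = (\<integral>y. exp (s\<^sup>2 / 2) * normal_density s 1 y \<partial>lborel)"
    by (intro Bochner_Integration.integral_cong refl)
      (simp add: normal_density_def mult_exp_exp power2_eq_square field_simps)
  also have "\<dots> = exp (s\<^sup>2 / 2)"
    by simp
  finally show ?thesis .
qed

lemma std_normal_moment:
  assumes Y: "distributed M lborel Y std_normal_density"
  shows "integrable M (\<lambda>\<omega>. Y \<omega> ^ m)"
    and "(\<integral>\<omega>. Y \<omega> ^ (2 * k) \<partial>M) = fact (2 * k) / (2 ^ k * fact k)"
    and "(\<integral>\<omega>. Y \<omega> ^ (2 * k + 1) \<partial>M) = 0"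
  using distributed_integrable[OF Y, of "\<lambda>y. y ^ m"] distributed_integral[OF Y, of "\<lambda>y. y ^ (2 * k)"]
    distributed_integral[OF Y, of "\<lambda>y. y ^ (2 * k + 1)"]
    integral_std_normal_moment_even[of k] integral_std_normal_moment_odd[of k]
    integrable_std_normal_moment[of m]
  by simp_all

lemma std_normal_deg_ffact:
  assumes Y: "distributed M lborel Y std_normal_density"
  shows "(\<integral>\<omega>. deg_ffact lam (Y \<omega>) n \<partial>M) = gauss_coeff lam 1 n"
proof -
  let ?f = "\<lambda>m. deg_ffact_coeff lam n m * (\<integral>\<omega>. Y \<omega> ^ m \<partial>M)"
  have "(\<integral>\<omega>. deg_ffact lam (Y \<omega>) n \<partial>M) = (\<Sum>m\<le>n. ?f m)"
    by (simp add: deg_ffact_monomials std_normal_moment[OF Y])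
  \<comment> \<open>Odd moments vanish. The doubled indices beyond n are harmless because their
    coefficients are zero.\<close>
  also have "\<dots> = (\<Sum>m\<in>(*) 2 ` {..n}. ?f m)"
  proof (rule sum.mono_neutral_cong)
    fix m assume "m \<in> {..n} - (*) 2 ` {..n}"
    then have "odd m" by (auto elim!: evenE)
    then show "?f m = 0"
      using std_normal_moment(3)[OF Y] by (auto elim!: oddE)
  qed (auto simp: deg_ffact_coeff_eq_0)
  also have "\<dots> = (\<Sum>k\<le>n. ?f (2 * k))"
    by (subst sum.reindex) (auto simp: inj_on_def)
  also have "\<dots> = gauss_coeff lam 1 n"
    by (simp add: gauss_coeff_def std_normal_moment(2)[OF Y] mult.commute[of "deg_ffact_coeff lam n _"])
  finally show ?thesis .
qed

lemma std_normal_deg_mgf: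
  assumes Y: "distributed M lborel Y std_normal_density" and "1 + lam * t > 0"
  shows "deg_mgf lam M Y t = exp ((ln (1 + lam * t) / lam)\<^sup>2 / 2)"
  using std_normal_mgf[OF Y, of "ln (1 + lam * t) / lam"] assms(2)
  by (simp add: deg_mgf_def deg_exp_def powr_def)

section \<open>Euler polynomials and the Cauchy product\<close>

lemma prob_deg_euler_eqI:
  assumes F: "(\<lambda>t. 2 / (deg_mgf lam M Y t + 1) * deg_mgf lam M Y t powr x) has_fps_expansion F"
  shows "prob_deg_euler lam M Y n x = F $ n * fact n"
proof -
  let ?f = "\<lambda>t. 2 / (deg_mgf lam M Y t + 1) * deg_mgf lam M Y t powr x"
  have "(THE c :: nat \<Rightarrow> real. \<forall>\<^sub>F t in nhds 0. (\<lambda>m. c m * t ^ m / fact m) sums ?f t)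
      = (\<lambda>n. F $ n * fact n)"
  proof (rule the_equality)
    show "\<forall>\<^sub>F t in nhds 0. (\<lambda>m. F $ m * fact m * t ^ m / fact m) sums ?f t"
      using has_fps_expansion_sums[OF F] by simp
  next
    fix c :: "nat \<Rightarrow> real"
    assume "\<forall>\<^sub>F t in nhds 0. (\<lambda>m. c m * t ^ m / fact m) sums ?f t"
    \<comment> \<open>Any other admissible sequence yields a second expansion of the same
      function.\<close>
    then have "?f has_fps_expansion Abs_fps (\<lambda>m. c m / fact m)"
      by (intro has_fps_expansionI) simp
    from has_fps_expansion_unique[OF F this] show "c = (\<lambda>n. F $ n * fact n)"
      by auto
  qed
  then show ?thesis
    unfolding prob_deg_euler_def by simp
qed

theorem theorem3p4:
  fixes M :: "'a measure" and Y :: "'a \<Rightarrow> real" and lam x :: real and n :: nat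
  assumes "prob_space M"
    and "distributed M lborel Y std_normal_density"
    and "lam \<noteq> 0"
  shows "1 / 2 * ((\<Sum>l=0..n. real (n choose l) * prob_deg_euler lam M Y l x
              * (\<integral>\<omega>. deg_ffact lam (Y \<omega>) (n - l) \<partial>M))
            + prob_deg_euler lam M Y n x)
       = (\<Sum>j=0..n. \<Sum>k=0..j div 2.
            fact (2 * k) / (2 ^ k * fact k) * S1 j (2 * k) * deg_S2 lam n j * x ^ k)"
proof -
  note Y = assms(2)
  define g where "g x t = exp (x * (ln (1 + lam * t) / lam)\<^sup>2 / 2)" for x t
  define G where "G x = Abs_fps (\<lambda>n. gauss_coeff lam x n / fact n)" for x
  define F where "F = fps_const 2 * G x / (G 1 + 1)"
  have gG: "g x has_fps_expansion G x" for x
    unfolding g_def G_def by (rule gauss_has_fps_expansion[OF assms(3)])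
  have "G 1 $ 0 = g 1 0"
    using has_fps_expansion_imp_0_eq_fps_nth_0[OF gG] by simp
  \<comment> \<open>The constant term is 1 + 1 = 2, so the denominator of F is invertible.\<close>
  then have nz: "(G 1 + 1) $ 0 \<noteq> 0"
    by (simp add: g_def)
  have "open ((\<lambda>t. 1 + lam * t) -` {0<..})"
    by (intro open_vimage continuous_intros open_greaterThan)
  from eventually_nhds_in_open[OF this, of 0] have "\<forall>\<^sub>F t in nhds 0. 1 + lam * t > 0"
    by simp
  \<comment> \<open>With the expectation equal to \<open>g 1 t\<close>, raising it to the power x
    gives \<open>g x t\<close>.\<close>
  then have "\<forall>\<^sub>F t in nhds 0. 2 / (deg_mgf lam M Y t + 1) * deg_mgf lam M Y t powr x
      = 2 * g x t / (g 1 t + 1)"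
    by eventually_elim (simp add: std_normal_deg_mgf[OF Y] g_def powr_def)
  moreover have "(\<lambda>t. 2 * g x t / (g 1 t + 1)) has_fps_expansion F"
    unfolding F_def by (intro fps_expansion_intros gG nz)
  ultimately have "(\<lambda>t. 2 / (deg_mgf lam M Y t + 1) * deg_mgf lam M Y t powr x) has_fps_expansion F"
    by (subst has_fps_expansion_cong[OF _ refl])
  note E = prob_deg_euler_eqI[OF this]
  have "F * G 1 + F = F * (G 1 + 1)"
    by (simp add: distrib_left)
  also have "\<dots> = fps_const 2 * G x * (inverse (G 1 + 1) * (G 1 + 1))"
    by (simp only: F_def fps_divide_unit[OF nz] mult.assoc)
  also have "\<dots> = fps_const 2 * G x"
    by (simp only: inverse_mult_eq_1[OF nz] mult_1_right)
  finally have "F * G 1 + F = fps_const 2 * G x" .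
  then have "(F * G 1) $ n + F $ n = 2 * G x $ n"
    by (metis fps_add_nth fps_mult_left_const_nth)
  then have *: "fact n * (F * G 1) $ n + F $ n * fact n = 2 * gauss_coeff lam x n"
    by (simp add: G_def field_simps)
  \<comment> \<open>The binomial coefficient n!/(l!(n-l)!) absorbs the factorials that distinguish
    exponential from ordinary coefficients.\<close>
  have "(\<Sum>l=0..n. real (n choose l) * prob_deg_euler lam M Y l x
      * (\<integral>\<omega>. deg_ffact lam (Y \<omega>) (n - l) \<partial>M)) = fact n * (F * G 1) $ n"
    unfolding fps_mult_nth sum_distrib_left
    by (intro sum.cong refl)
      (simp add: E std_normal_deg_ffact[OF Y] G_def binomial_fact field_simps)
  then show ?thesis
    using * by (simp add: E gauss_coeff_stirling)
qed

end
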